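(* Let $k\geqslant2$ be an integer. A sequence $(x_n)_{n\in\mathbb N}\subseteq[0,1]$ is uniformly distributed mod $1$ if and only if it has Poissonian $(k,0)$--correlations, i.e. $\lim_{N\to\infty}R_k(0;\mathcal R,N)=\lambda(\mathcal R)$ for every closed rectangle $\mathcal R=[a_1,b_1]\times\cdots\times[a_{k-1},b_{k-1}]\subseteq[-\frac12,\frac12]^{k-1}$.
   Context: For $x\in\mathbb R$, $(\!(x)\!)$ denotes the signed distance from $x$ to the nearest integer, i.e. the unique $y\in(-\frac12,\frac12]$ with $x-y\in\mathbb Z$. For $k\geqslant2$, $0\leqslant\beta\leqslant1$, $N\geqslant1$ and a closed rectangle $\mathcal R\subseteq\mathbb R^{k-1}$, $R_k(\beta;\mathcal R,N)=\frac{1}{N^{k-(k-1)\beta}}\#\{(i_1,\dots,i_k)\in\{1,\dots,N\}^k \text{ pairwise distinct}: N^{\beta}((\!(x_{i_1}-x_{i_2})\!),\dots,(\!(x_{i_1}-x_{i_k})\!))\in\mathcal R\}$. $\lambda$ is $(k-1)$-dimensional Lebesgue measure. Uniform distribution mod $1$ means $\lim_{N\to\infty}\frac1N\#\{i\leqslant N:x_i\in[a,b]\}=b-a$ for all $0\leqslant a<b\leqslant1$. *)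

theory Defs
  imports "HOL-Analysis.Analysis"
begin

definition signed_dist :: "real \<Rightarrow> real" where
  "signed_dist x = (THE y. - (1/2) < y \<and> y \<le> 1/2 \<and> x - y \<in> \<int>)"

lemma signed_dist_eqI:
  assumes "- (1/2) < y" "y \<le> 1/2" "x - y \<in> \<int>"
  shows "signed_dist x = y"
  unfolding signed_dist_def
proof (rule the_equality)
  show "- (1/2) < y \<and> y \<le> 1/2 \<and> x - y \<in> \<int>"
    using assms by simp
next
  fix z assume z: "- (1/2) < z \<and> z \<le> 1/2 \<and> x - z \<in> \<int>"
  have "(x - y) - (x - z) \<in> \<int>"
    using assms(3) z by (blast intro: Ints_diff)
  then obtain n :: int where n: "z - y = of_int n"
    by (auto elim: Ints_cases)
  with assms z have "-1 < real_of_int n" "real_of_int n < 1"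
    by linarith+
  then have "n = 0"
    by linarith
  with n show "z = y"
    by simp
qed

lemma signed_dist_ceiling: "signed_dist x = x - of_int \<lceil>x - 1/2\<rceil>"
  by (rule signed_dist_eqI) (linarith, linarith, simp)

lemma signed_dist_bounds: "- (1/2) < signed_dist x" "signed_dist x \<le> 1/2"
  and signed_dist_diff_Ints: "x - signed_dist x \<in> \<int>"
  unfolding signed_dist_ceiling by (linarith, linarith, simp)

text \<open>
  Points of \<open>\<real>\<^sup>k\<^sup>-\<^sup>1\<close> are extensional functions on \<open>{1..k-1}\<close>, so that sets of points live in the
  space of \<open>Pi\<^sub>M {1..k-1} (\<lambda>_. lborel)\<close>. Index tuples \<open>(i\<^sub>1, \<dots>, i\<^sub>k)\<close> are extensional functions
  on \<open>{1..k}\<close>, and sequences start at index 1.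
\<close>

definition scaled_differences :: "(nat \<Rightarrow> real) \<Rightarrow> nat \<Rightarrow> real \<Rightarrow> nat \<Rightarrow> (nat \<Rightarrow> nat) \<Rightarrow> (nat \<Rightarrow> real)" where
  "scaled_differences x k \<beta> N i =
     (\<lambda>m\<in>{1..k-1}. real N powr \<beta> * signed_dist (x (i 1) - x (i (m + 1))))"

definition correlation_count ::
    "(nat \<Rightarrow> real) \<Rightarrow> nat \<Rightarrow> real \<Rightarrow> (nat \<Rightarrow> real) set \<Rightarrow> nat \<Rightarrow> real" where
  "correlation_count x k \<beta> R N =
     1 / real N powr (real k - (real k - 1) * \<beta>) *
     real (card {i \<in> {1..k} \<rightarrow>\<^sub>E {1..N}. inj_on i {1..k} \<and> scaled_differences x k \<beta> N i \<in> R})"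

definition closed_rectangle :: "nat \<Rightarrow> (nat \<Rightarrow> real) set \<Rightarrow> bool" where
  "closed_rectangle d R \<longleftrightarrow>
     (\<exists>a b. (\<forall>m\<in>{1..d}. a m \<le> b m) \<and> R = (\<Pi>\<^sub>E m\<in>{1..d}. {a m..b m}))"

text \<open>For \<open>\<beta> = 0\<close> only rectangles inside \<open>[-1/2, 1/2]\<^sup>k\<^sup>-\<^sup>1\<close> are tested, since the differences are
  not rescaled.\<close>

definition poissonian_k0_correlations :: "nat \<Rightarrow> (nat \<Rightarrow> real) \<Rightarrow> bool" where
  "poissonian_k0_correlations k x \<longleftrightarrow>
     (\<forall>R. closed_rectangle (k - 1) R \<and> R \<subseteq> (\<Pi>\<^sub>E m\<in>{1..k-1}. {-(1/2)..1/2}) \<longrightarrow>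
        (\<lambda>N. correlation_count x k 0 R N) \<longlonglongrightarrow> measure (Pi\<^sub>M {1..k-1} (\<lambda>_. lborel)) R)"

definition uniformly_distributed_mod_1 :: "(nat \<Rightarrow> real) \<Rightarrow> bool" where
  "uniformly_distributed_mod_1 x \<longleftrightarrow>
     (\<forall>a b. 0 \<le> a \<and> a < b \<and> b \<le> 1 \<longrightarrow>
        (\<lambda>N. 1 / real N * real (card {i \<in> {1..N}. x i \<in> {a..b}})) \<longlonglongrightarrow> b - a)"

end

theory Submission imports Defs begin

text \<open>
  Tuples with a repeated index are negligible, and without the distinctness condition the count
  factors as \<open>\<Sum>\<^sub>j \<Prod>\<^sub>m #{l. signed_dist (x\<^sub>j - x\<^sub>l) \<in> [a\<^sub>m, b\<^sub>m]}\<close>. If \<open>x\<close> is uniformly distributed, each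
  factor is \<open>N (b\<^sub>m - a\<^sub>m) + o(N)\<close> uniformly in \<open>j\<close>, since finitely many bins control all arcs.

  Conversely, the rectangle \<open>[-c, c] \<times> [-1/2, 1/2]\<^sup>k\<^sup>-\<^sup>2\<close> yields the pair correlations. Cut the circle
  into \<open>L\<close> bins and let \<open>F\<^sub>s\<close> be the frequency of \<open>x\<close> in the window of \<open>m\<close> bins starting at bin \<open>s\<close>.
  The pair correlations bound \<open>\<Sum>\<^sub>s F\<^sub>s\<^sup>2\<close>, hence \<open>\<Sum>\<^sub>s (F\<^sub>s - m/L)\<^sup>2 \<le> m/L + o(1) < 1\<close>. An interval contained in
  \<open>q\<^sup>2\<close> windows therefore has frequency at most \<open>m/L + 1/q\<close>; with \<open>L = q\<^sup>3\<close> this is its length up to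
  \<open>O(1/q)\<close>. Such upper bounds suffice, by passing to complements.
\<close>

section \<open>Relative frequencies and union bounds\<close>

definition frequency :: "nat \<Rightarrow> (nat \<Rightarrow> bool) \<Rightarrow> real" where
  "frequency N P = real (card {i \<in> {1..N}. P i}) / real N"

lemma frequency_nonneg: "0 \<le> frequency N P"
  by (simp add: frequency_def)

lemma frequency_mono:
  assumes "\<And>i. 1 \<le> i \<Longrightarrow> i \<le> N \<Longrightarrow> P i \<Longrightarrow> Q i"
  shows "frequency N P \<le> frequency N Q"
  unfolding frequency_def using assms
  by (intro divide_right_mono of_nat_mono card_mono) auto

lemma frequency_cong:
  assumes "\<And>i. 1 \<le> i \<Longrightarrow> i \<le> N \<Longrightarrow> P i \<longleftrightarrow> Q i"
  shows "frequency N P = frequency N Q"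
  by (intro antisym frequency_mono) (use assms in auto)

lemma frequency_True: "N > 0 \<Longrightarrow> (\<And>i. 1 \<le> i \<Longrightarrow> i \<le> N \<Longrightarrow> P i) \<Longrightarrow> frequency N P = 1"
proof -
  assume "N > 0" and P: "\<And>i. 1 \<le> i \<Longrightarrow> i \<le> N \<Longrightarrow> P i"
  have "{i \<in> {1..N}. P i} = {1..N}" using P by auto
  with \<open>N > 0\<close> show ?thesis by (simp add: frequency_def)
qed

lemma frequency_le_1: "frequency N P \<le> 1"
proof (cases "N = 0")
  case False
  have "frequency N P \<le> frequency N (\<lambda>_. True)" by (rule frequency_mono) simp
  also have "\<dots> = 1" using False by (intro frequency_True) auto
  finally show ?thesis .
qed (simp add: frequency_def)

lemma frequency_cover:
  assumes "finite Q" and "\<And>i. 1 \<le> i \<Longrightarrow> i \<le> N \<Longrightarrow> P i \<Longrightarrow> \<exists>q\<in>Q. S q i"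
  shows "frequency N P \<le> (\<Sum>q\<in>Q. frequency N (S q))"
proof -
  have "card {i \<in> {1..N}. P i} \<le> card (\<Union>q\<in>Q. {i \<in> {1..N}. S q i})"
    using assms by (intro card_mono) auto
  also have "\<dots> \<le> (\<Sum>q\<in>Q. card {i \<in> {1..N}. S q i})"
    by (rule card_UN_le[OF assms(1)])
  finally have "real (card {i \<in> {1..N}. P i}) \<le> (\<Sum>q\<in>Q. real (card {i \<in> {1..N}. S q i}))"
    by (simp flip: of_nat_sum)
  then show ?thesis
    unfolding frequency_def sum_divide_distrib[symmetric] by (rule divide_right_mono) simp
qed

text \<open>Serves to turn upper bounds into lower ones: once two of the three covering events are
  bounded above, the third is bounded below.\<close>

lemma frequency_cover3:
  assumes "N > 0" and "\<And>i. 1 \<le> i \<Longrightarrow> i \<le> N \<Longrightarrow> P i \<or> Q i \<or> S i"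
  shows "1 \<le> frequency N P + frequency N Q + frequency N S"
proof -
  have "1 = frequency N (\<lambda>_. True)" using assms(1) by (simp add: frequency_True)
  also have "\<dots> \<le> (\<Sum>q\<in>{0,1,2::nat}. frequency N (if q = 0 then P else if q = 1 then Q else S))"
    using assms(2) by (intro frequency_cover) auto
  finally show ?thesis by simp
qed

lemma frequency_eq_sum: "frequency N P = (\<Sum>i=1..N. of_bool (P i)) / real N"
proof -
  have "(\<Sum>i=1..N. of_bool (P i)) = real (card ({1..N} \<inter> {i. P i}))"
    by simp
  moreover have "{1..N} \<inter> {i. P i} = {i \<in> {1..N}. P i}" by auto
  ultimately show ?thesis by (simp add: frequency_def)
qed

lemma uniformly_distributed_mod_1_iff:
  "uniformly_distributed_mod_1 x \<longleftrightarrow>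
     (\<forall>a b. 0 \<le> a \<and> a < b \<and> b \<le> 1 \<longrightarrow> (\<lambda>N. frequency N (\<lambda>i. x i \<in> {a..b})) \<longlonglongrightarrow> b - a)"
  unfolding uniformly_distributed_mod_1_def frequency_def by simp

text \<open>If \<open>n\<close> is not the integer \<open>l\<close> with
  \<open>t - signed_dist t = l\<close>, it differs from \<open>l\<close> by at least 1, so
  \<open>t\<close> is at distance at least 1/2 from \<open>n\<close>.\<close>

lemma abs_signed_dist_le: "\<bar>signed_dist t\<bar> \<le> \<bar>t - of_int n\<bar>"
proof (cases "t - of_int n = signed_dist t")
  case False
  have "t - signed_dist t \<in> \<int>" by (rule signed_dist_diff_Ints)
  then obtain l where l: "t - signed_dist t = of_int l" by (auto elim: Ints_cases)
  with False have "n \<noteq> l" by auto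
  then have "n \<le> l - 1 \<or> n \<ge> l + 1" by linarith
  then have "real_of_int n \<le> of_int l - 1 \<or> real_of_int n \<ge> of_int l + 1" by linarith
  then show ?thesis using l signed_dist_bounds[of t] by linarith
qed simp

section \<open>Uniformity in the position of the interval\<close>

text \<open>The condition confines \<open>x j\<close> modulo 1 to the arc from \<open>y - b\<close>
  to \<open>y - a\<close>. Closed bins of width \<open>1/K\<close> cover this arc, at most
  \<open>K * (b - a) + 2\<close> of them wherever it lies. As only \<open>K\<close> fixed bins occur
  modulo 1, one threshold for \<open>N\<close> serves all \<open>y\<close>, \<open>a\<close> and
  \<open>b\<close>.\<close>

lemma frequency_signed_dist_upper:
  assumes ud: "uniformly_distributed_mod_1 x" and x: "\<And>n. n \<ge> 1 \<Longrightarrow> x n \<in> {0..1}"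
    and "\<epsilon> > 0"
  shows "\<forall>\<^sub>F N in sequentially. \<forall>y a b. a \<le> b \<and> b \<le> a + 1 \<longrightarrow>
           frequency N (\<lambda>j. signed_dist (y - x j) \<in> {a..b}) \<le> b - a + \<epsilon>"
proof -
  \<comment> \<open>The constant 5 anticipates the final excess
    \<open>(2 + (b - a))/K + 2/K^2\<close>, which is at most \<open>5/K\<close> because
    \<open>b - a \<le> 1\<close>.\<close>
  obtain K0 :: nat where K0: "5 / \<epsilon> < real K0" using reals_Archimedean2 by blast
  define K :: int where "K = int K0 + 1"
  have K: "K \<ge> 1" "5 / K < \<epsilon>"
    using K0 \<open>\<epsilon> > 0\<close> by (auto simp: K_def field_simps intro: less_trans)
  define bin where "bin r = {real_of_int r / K .. (real_of_int r + 1) / K}" for r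
  have ev: "\<forall>\<^sub>F N in sequentially. \<forall>r\<in>{0..<K}. frequency N (\<lambda>j. x j \<in> bin r) < 1/K + 1/K^2"
  proof (intro eventually_ball_finite ballI)
    fix r assume r: "r \<in> {0..<K}"
    have "real_of_int r + 1 \<le> K" using r by (simp; linarith)
    with r K have "(\<lambda>N. frequency N (\<lambda>j. x j \<in> bin r)) \<longlonglongrightarrow> (real_of_int r + 1) / K - real_of_int r / K"
      unfolding bin_def
      by (intro ud[unfolded uniformly_distributed_mod_1_iff, rule_format]) (auto simp: field_simps)
    then show "\<forall>\<^sub>F N in sequentially. frequency N (\<lambda>j. x j \<in> bin r) < 1/K + 1/K^2"
      using K by (intro order_tendstoD(2)) (auto simp: diff_divide_distrib[symmetric])
  qed simp
  from ev show ?thesis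
  proof (eventually_elim, intro allI impI)
    fix N y a b
    assume bins: "\<forall>r\<in>{0..<K}. frequency N (\<lambda>j. x j \<in> bin r) < 1/K + 1/K^2"
      and ab: "a \<le> b \<and> b \<le> a + (1::real)"
    \<comment> \<open>\<open>Q\<close> numbers bins along the real line, before reduction modulo
      \<open>K\<close>. The \<open>- 1\<close> admits the bin that starts left of
      \<open>y - b\<close> but still meets the arc.\<close>
    define Q where "Q = {\<lceil>K * (y - b) - 1\<rceil>..\<lfloor>K * (y - a)\<rfloor>}"
    have "frequency N (\<lambda>j. signed_dist (y - x j) \<in> {a..b})
            \<le> (\<Sum>q\<in>Q. frequency N (\<lambda>j. x j \<in> bin (q mod K)))"
    proof (rule frequency_cover)
      fix j assume j: "1 \<le> j" "signed_dist (y - x j) \<in> {a..b}"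
      obtain n where n: "y - x j - signed_dist (y - x j) = of_int n"
        using signed_dist_diff_Ints by (auto elim: Ints_cases)
      \<comment> \<open>The minimum puts the point 1 into the last bin \<open>K - 1\<close>, whose
        closed right end is 1.\<close>
      define B where "B = min \<lfloor>K * x j\<rfloor> (K - 1)"
      have xj: "0 \<le> x j" "x j \<le> 1" using x j by auto
      have "K * x j \<ge> 0" "K * x j \<le> K" using xj K by (auto simp: mult_le_cancel_left1)
      then have B: "0 \<le> B" "B < K" "B \<le> K * x j" "K * x j \<le> B + 1"
        using K by (auto simp: B_def min_def) linarith+
      have u: "y - b \<le> x j + of_int n" "x j + of_int n \<le> y - a" using n j by auto
      have "K * (y - b) \<le> K * (x j + n)" "K * (x j + n) \<le> K * (y - a)"
        using K by (auto intro!: mult_left_mono u)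
      then have "K * (y - b) - 1 \<le> real_of_int (B + K * n)" "real_of_int (B + K * n) \<le> K * (y - a)"
        using B by (simp_all add: algebra_simps)
      then have "B + K * n \<in> Q"
        unfolding Q_def by (simp only: atLeastAtMost_iff ceiling_le_iff le_floor_iff simp_thms)
      moreover have "(B + K * n) mod K = B" using B by simp
      moreover have "x j \<in> bin B"
        using B K by (simp add: bin_def field_simps)
      ultimately show "\<exists>q\<in>Q. x j \<in> bin (q mod K)" by metis
    qed (simp add: Q_def)
    also have "\<dots> \<le> (\<Sum>q\<in>Q. 1/K + 1/K^2)"
      using bins K by (intro sum_mono less_imp_le) auto
    also have "\<dots> = real (card Q) * (1/K + 1/K^2)" by simp
    also have "\<dots> \<le> (K * (b - a) + 2) * (1/K + 1/K^2)"
    proof (rule mult_right_mono)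
      have "0 \<le> K * (b - a)" using ab K by simp
      then show "real (card Q) \<le> K * (b - a) + 2"
        unfolding Q_def card_atLeastAtMost_int by (simp add: algebra_simps) linarith
    qed (use K in auto)
    also have "\<dots> = (b - a) + (2 + (b - a)) / K + 2/K^2"
      using K by (simp add: field_simps power2_eq_square)
    also have "\<dots> \<le> (b - a) + 3 / K + 2/K"
      using K ab by (intro add_mono divide_right_mono divide_left_mono) (auto simp: power2_eq_square)
    also have "\<dots> = (b - a) + 5 / K" by (simp add: add_divide_distrib[symmetric])
    finally show "frequency N (\<lambda>j. signed_dist (y - x j) \<in> {a..b}) \<le> b - a + \<epsilon>"
      using K by linarith
  qed
qed

text \<open>The lower bound comes from the upper bounds for \<open>{-(1/2)..a}\<close> and
  \<open>{b..1/2}\<close>, which together with \<open>{a..b}\<close> exhaust the range of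
  \<open>signed_dist\<close>; their two errors \<open>\<epsilon>/2\<close> add up to
  \<open>\<epsilon>\<close>.\<close>

lemma frequency_signed_dist_uniform:
  assumes ud: "uniformly_distributed_mod_1 x" and x: "\<And>n. n \<ge> 1 \<Longrightarrow> x n \<in> {0..1}"
    and "\<epsilon> > 0"
  shows "\<forall>\<^sub>F N in sequentially. \<forall>y a b. -(1/2) \<le> a \<and> a \<le> b \<and> b \<le> 1/2 \<longrightarrow>
           \<bar>frequency N (\<lambda>j. signed_dist (y - x j) \<in> {a..b}) - (b - a)\<bar> \<le> \<epsilon>"
proof -
  have "\<forall>\<^sub>F N in sequentially. \<forall>y a b. a \<le> b \<and> b \<le> a + 1 \<longrightarrow>
           frequency N (\<lambda>j. signed_dist (y - x j) \<in> {a..b}) \<le> b - a + \<epsilon>/2"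
    using assms by (intro frequency_signed_dist_upper) auto
  from this eventually_gt_at_top[of 0]
  show ?thesis
  proof (eventually_elim, intro allI impI)
    fix N y a b
    assume up: "\<forall>y a b. a \<le> b \<and> b \<le> a + 1 \<longrightarrow>
           frequency N (\<lambda>j. signed_dist (y - x j) \<in> {a..b}) \<le> b - a + \<epsilon>/2"
      and "0 < N" and ab: "-(1/2) \<le> a \<and> a \<le> b \<and> b \<le> (1/2::real)"
    let ?F = "\<lambda>a b. frequency N (\<lambda>j. signed_dist (y - x j) \<in> {a..b})"
    have "?F a b \<le> b - a + \<epsilon>/2" "?F (-(1/2)) a \<le> a - (-(1/2)) + \<epsilon>/2" "?F b (1/2) \<le> 1/2 - b + \<epsilon>/2"
      using ab by (intro up[rule_format]; linarith)+
    moreover have "1 \<le> ?F a b + ?F (-(1/2)) a + ?F b (1/2)"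
    proof (rule frequency_cover3)
      fix i
      show "signed_dist (y - x i) \<in> {a..b} \<or> signed_dist (y - x i) \<in> {-(1/2)..a} \<or>
          signed_dist (y - x i) \<in> {b..1/2}"
        using signed_dist_bounds[of "y - x i"] by auto
    qed fact
    ultimately show "\<bar>?F a b - (b - a)\<bar> \<le> \<epsilon>" using \<open>\<epsilon> > 0\<close> by linarith
  qed
qed

section \<open>From pair correlations to uniform distribution\<close>

text \<open>Sending \<open>s\<close> to \<open>(c - s) mod L\<close> is an involution on the
  residues and carries the set onto \<open>{0..<int m}\<close>. In terms of windows, every bin
  belongs to exactly \<open>m\<close> of them.\<close>

lemma card_shifts:
  fixes L c :: int
  assumes "0 < L" "int m \<le> L"
  shows "card {s \<in> {0..<L}. (c - s) mod L < int m} = m"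
proof -
  have "bij_betw (\<lambda>s. (c - s) mod L) {s \<in> {0..<L}. (c - s) mod L < int m} {0..<int m}"
    using assms
    by (intro bij_betw_byWitness[where f' = "\<lambda>s. (c - s) mod L"]) (auto simp: mod_simps)
  from bij_betw_same_card[OF this] show ?thesis by simp
qed

text \<open>Send the start \<open>s\<close> of a window holding both points to the larger of their
  two bin offsets from \<open>s\<close>. This is a value \<open>v < m\<close>, distinct windows give
  distinct values, and points at offsets at most \<open>v\<close> are at most \<open>v + 1\<close>
  bin widths apart. Counting by radii makes the bound expressible through pair correlations.\<close>

lemma card_common_shifts_le:
  fixes L :: int and x y :: real
  assumes "0 < L" "2 * int m \<le> L"
  shows "card {s \<in> {0..<L}. (\<lfloor>L * x\<rfloor> - s) mod L < int m \<and> (\<lfloor>L * y\<rfloor> - s) mod L < int m}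
           \<le> card {v \<in> {..<m}. \<bar>signed_dist (x - y)\<bar> \<le> (real v + 1) / L}"
    (is "card ?S \<le> card ?V")
proof -
  define u where "u s = (\<lfloor>L * x\<rfloor> - s) mod L" for s
  define w where "w s = (\<lfloor>L * y\<rfloor> - s) mod L" for s
  have uw: "0 \<le> u s" "0 \<le> w s" for s using assms by (simp_all add: u_def w_def)
  have S: "s \<in> {0..<L}" "u s < m" "w s < m" if "s \<in> ?S" for s
    using that by (auto simp: u_def w_def)
  have uw_mod: "(u s - w s) mod L = (\<lfloor>L * x\<rfloor> - \<lfloor>L * y\<rfloor>) mod L" for s
    by (simp add: u_def w_def mod_simps)
  \<comment> \<open>The offset between the two residues does not depend on the shift, because \<open>2 m \<le> L\<close>;
      so the larger residue always belongs to the same point and determines the shift.\<close>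
  have const: "u s - w s = u s' - w s'" if "s \<in> ?S" "s' \<in> ?S" for s s'
  proof -
    have "L dvd (u s - w s) - (u s' - w s')"
      using uw_mod[of s] uw_mod[of s'] by (simp only: mod_eq_dvd_iff[symmetric])
    moreover have "\<bar>(u s - w s) - (u s' - w s')\<bar> < L"
      using S[OF that(1)] S[OF that(2)] uw[of s] uw[of s'] assms by linarith
    ultimately have "(u s - w s) - (u s' - w s') = 0"
      by (metis abs_ge_self dvd_imp_le_int leD order_trans)
    then show ?thesis by simp
  qed
  have inv: "s = (\<lfloor>L * x\<rfloor> - u s) mod L" "s = (\<lfloor>L * y\<rfloor> - w s) mod L" if "s \<in> ?S" for s
    using S[OF that] by (simp_all add: u_def w_def mod_simps)
  have "inj_on (\<lambda>s. nat (max (u s) (w s))) ?S"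
  proof (rule inj_onI)
    fix s s' assume s: "s \<in> ?S" "s' \<in> ?S" and "nat (max (u s) (w s)) = nat (max (u s') (w s'))"
    then have "max (u s) (w s) = max (u s') (w s')" using uw[of s] uw[of s'] by linarith
    then have "u s = u s'" using const[OF s] by linarith
    then show "s = s'" using inv(1)[OF s(1)] inv(1)[OF s(2)] by simp
  qed
  moreover have "(\<lambda>s. nat (max (u s) (w s))) ` ?S \<subseteq> ?V"
  proof (rule image_subsetI)
    fix s assume s: "s \<in> ?S"
    have "L dvd (\<lfloor>L * x\<rfloor> - \<lfloor>L * y\<rfloor>) - (u s - w s)"
      using uw_mod[of s] by (simp add: mod_eq_dvd_iff[symmetric])
    then obtain n where n: "(\<lfloor>L * x\<rfloor> - \<lfloor>L * y\<rfloor>) - (u s - w s) = L * n" ..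
    then have "real_of_int \<lfloor>L * x\<rfloor> - \<lfloor>L * y\<rfloor> = (u s - w s) + L * n"
      by (metis add.commute diff_eq_eq of_int_diff of_int_add of_int_mult)
    \<comment> \<open>Each floor is less than 1 below its argument, so replacing floors by arguments
      changes the difference by less than 1; and \<open>\<bar>u s - w s\<bar>\<close> is at most the
      maximum, both being nonnegative.\<close>
    then have "\<bar>L * x - L * y - L * n\<bar> \<le> max (u s) (w s) + 1"
      using uw[of s] floor_correct[of "L * x"] floor_correct[of "L * y"]
      by (simp add: max_def) linarith
    moreover have "L * x - L * y - L * n = L * (x - y - n)" by (simp add: algebra_simps)
    ultimately have "L * \<bar>x - y - n\<bar> \<le> max (u s) (w s) + 1"
      using assms by (simp add: abs_mult)
    then have "\<bar>x - y - n\<bar> \<le> (max (u s) (w s) + 1) / L"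
      using assms by (simp add: pos_le_divide_eq mult.commute)
    then have "\<bar>signed_dist (x - y)\<bar> \<le> (max (u s) (w s) + 1) / L"
      using abs_signed_dist_le[of "x - y" n] by linarith
    moreover have "real (nat (max (u s) (w s))) = max (u s) (w s)"
      using uw[of s] by (simp add: max_def)
    ultimately show "nat (max (u s) (w s)) \<in> ?V"
      using S[OF s] uw[of s] by auto
  qed
  ultimately show ?thesis by (intro card_inj_on_le) auto
qed

section \<open>Second moment of the window frequencies\<close>

text \<open>Reduction modulo \<open>L\<close> makes the windows wrap around the circle; in
  particular the point 1 shares bin 0 with the point 0, in accordance with
  \<open>signed_dist\<close>.\<close>

definition window_freq :: "(nat \<Rightarrow> real) \<Rightarrow> nat \<Rightarrow> int \<Rightarrow> nat \<Rightarrow> int \<Rightarrow> real" where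
  "window_freq x N L m s = frequency N (\<lambda>i. (\<lfloor>L * x i\<rfloor> - s) mod L < int m)"

text \<open>The average includes the diagonal, which for \<open>c \<ge> 0\<close> contributes
  \<open>1/N\<close> and so vanishes in the limit.\<close>

definition pair_freq :: "(nat \<Rightarrow> real) \<Rightarrow> nat \<Rightarrow> real \<Rightarrow> real" where
  "pair_freq x N c = (\<Sum>i=1..N. frequency N (\<lambda>j. \<bar>signed_dist (x i - x j)\<bar> \<le> c)) / real N"

lemma sum_of_bool_card: "finite A \<Longrightarrow> (\<Sum>s\<in>A. of_bool (P s)) = real (card {s \<in> A. P s})"
  by (simp add: Int_def)

text \<open>Double counting: by \<open>card_shifts\<close> each of the \<open>N\<close> points is in
  exactly \<open>m\<close> windows.\<close>

lemma sum_window_freq: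
  assumes "0 < L" "int m \<le> L" "0 < N"
  shows "(\<Sum>s\<in>{0..<L}. window_freq x N L m s) = real m"
proof -
  have "(\<Sum>s\<in>{0..<L}. window_freq x N L m s)
          = (\<Sum>s\<in>{0..<L}. \<Sum>i=1..N. of_bool ((\<lfloor>L * x i\<rfloor> - s) mod L < int m)) / real N"
    unfolding window_freq_def frequency_eq_sum sum_divide_distrib ..
  also have "(\<Sum>s\<in>{0..<L}. \<Sum>i=1..N. of_bool ((\<lfloor>L * x i\<rfloor> - s) mod L < int m))
          = (\<Sum>i=1..N. \<Sum>s\<in>{0..<L}. (of_bool ((\<lfloor>L * x i\<rfloor> - s) mod L < int m) :: real))"
    by (rule sum.swap)
  also have "\<dots> = (\<Sum>i=1..N. real m)"
    by (intro sum.cong refl)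
       (simp only: sum_of_bool_card finite_atLeastLessThan_int card_shifts[OF assms(1,2)])
  finally show ?thesis using assms by simp
qed

text \<open>Expanding the squares gives a sum over pairs of points of the number of windows holding
  both, divided by \<open>N^2\<close>. Bounding that number by \<open>card_common_shifts_le\<close>
  and exchanging sums leaves one pair frequency for each radius \<open>(v + 1)/L\<close>.\<close>

lemma sum_window_freq_squares:
  assumes "0 < L" "2 * int m \<le> L"
  shows "(\<Sum>s\<in>{0..<L}. (window_freq x N L m s)\<^sup>2) \<le> (\<Sum>v<m. pair_freq x N ((real v + 1) / L))"
proof -
  define f where "f i s = (of_bool ((\<lfloor>L * x i\<rfloor> - s) mod L < int m) :: real)" for i s
  define g where "g i j v = (of_bool (\<bar>signed_dist (x i - x j)\<bar> \<le> (real v + 1) / L) :: real)" for i j v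
  have fg: "(\<Sum>s\<in>{0..<L}. f i s * f j s) \<le> (\<Sum>v<m. g i j v)" for i j
  proof -
    have "(\<Sum>s\<in>{0..<L}. f i s * f j s)
            = (\<Sum>s\<in>{0..<L}. of_bool ((\<lfloor>L * x i\<rfloor> - s) mod L < int m \<and> (\<lfloor>L * x j\<rfloor> - s) mod L < int m))"
      by (simp add: f_def of_bool_conj)
    also have "\<dots> = real (card {s\<in>{0..<L}. (\<lfloor>L * x i\<rfloor> - s) mod L < int m \<and> (\<lfloor>L * x j\<rfloor> - s) mod L < int m})"
      by (rule sum_of_bool_card) simp
    also have "\<dots> \<le> real (card {v \<in> {..<m}. \<bar>signed_dist (x i - x j)\<bar> \<le> (real v + 1) / L})"
      using card_common_shifts_le[OF assms] by simp
    also have "\<dots> = (\<Sum>v<m. g i j v)"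
      unfolding g_def by (rule sum_of_bool_card[symmetric]) simp
    finally show ?thesis .
  qed
  have "(\<Sum>s\<in>{0..<L}. (window_freq x N L m s)\<^sup>2)
          = (\<Sum>s\<in>{0..<L}. \<Sum>i=1..N. \<Sum>j=1..N. f i s * f j s) / (real N)\<^sup>2"
    unfolding window_freq_def frequency_eq_sum f_def[symmetric]
    by (simp add: power_divide sum_divide_distrib power2_eq_square sum_product)
  also have "(\<Sum>s\<in>{0..<L}. \<Sum>i=1..N. \<Sum>j=1..N. f i s * f j s)
          = (\<Sum>i=1..N. \<Sum>s\<in>{0..<L}. \<Sum>j=1..N. f i s * f j s)"
    by (rule sum.swap)
  also have "\<dots> = (\<Sum>i=1..N. \<Sum>j=1..N. \<Sum>s\<in>{0..<L}. f i s * f j s)"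
    by (rule sum.cong[OF refl], rule sum.swap)
  also have "\<dots> / (real N)\<^sup>2 \<le> (\<Sum>i=1..N. \<Sum>j=1..N. \<Sum>v<m. g i j v) / (real N)\<^sup>2"
    by (intro divide_right_mono sum_mono fg) simp
  also have "(\<Sum>i=1..N. \<Sum>j=1..N. \<Sum>v<m. g i j v) = (\<Sum>i=1..N. \<Sum>v<m. \<Sum>j=1..N. g i j v)"
    by (rule sum.cong[OF refl], rule sum.swap)
  also have "\<dots> = (\<Sum>v<m. \<Sum>i=1..N. \<Sum>j=1..N. g i j v)"
    by (rule sum.swap)
  also have "\<dots> / (real N)\<^sup>2 = (\<Sum>v<m. pair_freq x N ((real v + 1) / L))"
    unfolding pair_freq_def frequency_eq_sum g_def[symmetric]
    by (simp add: sum_divide_distrib power2_eq_square)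
  finally show ?thesis .
qed

text \<open>By \<open>sum_window_freq\<close> the mean over the windows is \<open>m/L\<close>, so
  the squared deviations sum to the squares minus \<open>m^2/L\<close>.\<close>

lemma window_freq_variance:
  assumes "0 < L" "2 * int m \<le> L" "0 < N"
  shows "(\<Sum>s\<in>{0..<L}. (window_freq x N L m s - m / L)\<^sup>2)
           \<le> (\<Sum>v<m. pair_freq x N ((real v + 1) / L)) - (real m)\<^sup>2 / L"
proof -
  have mL: "int m \<le> L" using assms by linarith
  have "(\<Sum>s\<in>{0..<L}. (window_freq x N L m s - m / L)\<^sup>2)
      = (\<Sum>s\<in>{0..<L}. (window_freq x N L m s)\<^sup>2) - 2 * (m / L) * (\<Sum>s\<in>{0..<L}. window_freq x N L m s)
         + L * (m / L)\<^sup>2"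
    using assms(1) by (simp add: power2_diff sum.distrib sum_subtractf sum_distrib_left sum_divide_distrib mult_ac)
  also have "\<dots> = (\<Sum>s\<in>{0..<L}. (window_freq x N L m s)\<^sup>2) - (real m)\<^sup>2 / L"
    using assms(1) unfolding sum_window_freq[OF assms(1) mL assms(3)]
    by (simp add: field_simps power2_eq_square)
  finally show ?thesis using sum_window_freq_squares[OF assms(1,2), of x N] by linarith
qed

section \<open>From window frequencies to intervals\<close>

text \<open>In the limit the variance bound becomes \<open>m * (m + 1)/L - m^2/L = m/L\<close>,
  which is below 1. If the frequency in \<open>{a..b}\<close> exceeded \<open>m/L + 1/q\<close>,
  each of the \<open>q^2\<close> windows around the interval would contribute more than
  \<open>1/q^2\<close> to the variance, a contradiction.\<close>

lemma pair_freq_short_interval: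
  assumes G: "\<And>c. 0 \<le> c \<Longrightarrow> c \<le> 1/2 \<Longrightarrow> (\<lambda>N. pair_freq x N c) \<longlonglongrightarrow> 2 * c"
    and ab: "a \<le> b" "b - a \<le> 1/4" and q: "q \<ge> 5"
  shows "\<forall>\<^sub>F N in sequentially. frequency N (\<lambda>i. x i \<in> {a..b}) \<le> b - a + 3 / real q"
proof -
  \<comment> \<open>\<open>M\<close> bins span the interval, and a window needs
    \<open>q^2 - 1\<close> spare bins to contain them from \<open>q^2\<close> starting positions.
    With \<open>L = q^3\<close> the spare bins have total length below \<open>1/q\<close>.\<close>
  define L where "L = int (q ^ 3)"
  define M where "M = nat (\<lfloor>L * b\<rfloor> - \<lfloor>L * a\<rfloor> + 1)"
  define m where "m = M + q\<^sup>2 - 1"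
  have L: "0 < L" using q by (simp add: L_def)
  have q2: "5 * q\<^sup>2 \<le> q ^ 3" "25 \<le> q\<^sup>2"
    using q mult_le_mono1[OF q, of "q\<^sup>2"] power_mono[OF q, of 2] by (simp_all add: power3_eq_cube power2_eq_square)
  have q2L: "5 * (real q)\<^sup>2 \<le> L" "25 \<le> (real q)\<^sup>2"
    using of_nat_mono[OF q2(1), where 'a=real] of_nat_mono[OF q2(2), where 'a=real] by (simp_all add: L_def)
  have "L * a \<le> L * b" using ab L by simp
  then have "\<lfloor>L * a\<rfloor> \<le> \<lfloor>L * b\<rfloor>" by (rule floor_mono)
  then have M: "int M = \<lfloor>L * b\<rfloor> - \<lfloor>L * a\<rfloor> + 1" by (simp add: M_def)
  then have "real M = \<lfloor>L * b\<rfloor> - \<lfloor>L * a\<rfloor> + 1" by (metis of_int_of_nat_eq of_int_add of_int_diff of_int_1)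
  then have M_le: "real M \<le> L * (b - a) + 2" by (simp add: algebra_simps) linarith
  have m_eq: "int m = int M + int (q\<^sup>2) - 1" using q2 by (simp add: m_def)
  then have m_real: "real m = real M + (real q)\<^sup>2 - 1"
    by (metis of_int_of_nat_eq of_int_add of_int_diff of_int_1 of_nat_power)
  \<comment> \<open>With length at most 1/4, \<open>2 * m\<close> is at most
    \<open>L/2 + 2 * q^2 + 2\<close>; the bounds \<open>5 * q^2 \<le> L\<close> and
    \<open>25 \<le> q^2\<close> make this at most \<open>L\<close>.\<close>
  have "L * (b - a) \<le> L * (1/4)" using ab L by (intro mult_left_mono) auto
  then have "2 * real m \<le> L" using M_le m_real q2L by linarith
  then have mL: "2 * int m \<le> L" by linarith
  have "(\<lambda>N. \<Sum>v<m. pair_freq x N ((real v + 1) / L)) \<longlonglongrightarrow> (\<Sum>v<m. 2 * ((real v + 1) / L))"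
  proof (intro tendsto_sum G)
    fix v assume "v \<in> {..<m}"
    then have "real v + 1 \<le> real m" by auto
    then have "2 * (real v + 1) \<le> 2 * real m" by simp
    also note \<open>2 * real m \<le> L\<close>
    finally have "2 * (real v + 1) \<le> L" .
    then show "(real v + 1) / L \<le> 1/2" using L by (simp add: field_simps)
  qed (use L in auto)
  moreover have "(\<Sum>v<n. 2 * ((real v + 1) / L)) = real n * (real n + 1) / L" for n
    using L by (induction n) (auto simp: field_simps)
  ultimately have "(\<lambda>N. \<Sum>v<m. pair_freq x N ((real v + 1) / L)) \<longlonglongrightarrow> real m * (real m + 1) / L"
    by simp
  moreover have "real m * (real m + 1) / L < (real m)\<^sup>2 / L + 1"
    using L \<open>2 * real m \<le> L\<close> by (simp add: field_simps power2_eq_square)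
  ultimately have "\<forall>\<^sub>F N in sequentially. (\<Sum>v<m. pair_freq x N ((real v + 1) / L)) < (real m)\<^sup>2 / L + 1"
    by (rule order_tendstoD(2))
  with eventually_gt_at_top[of 0] show ?thesis
  proof eventually_elim
    case (elim N)
    define P where "P = frequency N (\<lambda>i. x i \<in> {a..b})"
    have var: "(\<Sum>s\<in>{0..<L}. (window_freq x N L m s - m / L)\<^sup>2) < 1"
      using window_freq_variance[OF L mL elim(1), of x] elim(2) by linarith
    \<comment> \<open>The starting positions arise by stepping back \<open>t < q^2\<close> bins from
      the bin of \<open>a\<close>; they are distinct modulo \<open>L\<close> because
      \<open>q^2 \<le> L\<close>.\<close>
    define S where "S = (\<lambda>t. (\<lfloor>L * a\<rfloor> - t) mod L) ` {0..<int (q\<^sup>2)}"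
    have q2_le_L: "int (q\<^sup>2) \<le> L" using q2(1) unfolding L_def by (simp only: of_nat_le_iff)
    have "inj_on (\<lambda>t. (\<lfloor>L * a\<rfloor> - t) mod L) {0..<int (q\<^sup>2)}"
    proof (rule inj_onI)
      fix t t' assume t: "t \<in> {0..<int (q\<^sup>2)}" "t' \<in> {0..<int (q\<^sup>2)}"
        and "(\<lfloor>L * a\<rfloor> - t) mod L = (\<lfloor>L * a\<rfloor> - t') mod L"
      then have "(\<lfloor>L * a\<rfloor> - (\<lfloor>L * a\<rfloor> - t) mod L) mod L = (\<lfloor>L * a\<rfloor> - (\<lfloor>L * a\<rfloor> - t') mod L) mod L"
        by simp
      then have "t mod L = t' mod L" by (simp add: mod_simps)
      then show "t = t'" using t q2_le_L by simp
    qed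
    then have cardS: "card S = q\<^sup>2" unfolding S_def by (subst card_image) (simp_all del: of_nat_power)
    have PF: "P \<le> window_freq x N L m s" if sS: "s \<in> S" for s
      unfolding P_def window_freq_def
    proof (rule frequency_mono)
      fix i assume "x i \<in> {a..b}"
      then have "L * a \<le> L * x i" "L * x i \<le> L * b" using L by auto
      then have fl: "\<lfloor>L * a\<rfloor> \<le> \<lfloor>L * x i\<rfloor>" "\<lfloor>L * x i\<rfloor> \<le> \<lfloor>L * b\<rfloor>" by (auto intro: floor_mono)
      obtain t where t: "t \<in> {0..<int (q\<^sup>2)}" "s = (\<lfloor>L * a\<rfloor> - t) mod L"
        using sS by (auto simp: S_def simp del: of_nat_power)
      have "(\<lfloor>L * x i\<rfloor> - s) mod L = (\<lfloor>L * x i\<rfloor> - \<lfloor>L * a\<rfloor> + t) mod L"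
        unfolding t(2) by (simp add: mod_simps algebra_simps)
      \<comment> \<open>The offset is at most \<open>(M - 1) + (q^2 - 1) = m - 1\<close>, which is
        below \<open>L\<close>, so the reduction has no effect.\<close>
      also have "\<dots> = \<lfloor>L * x i\<rfloor> - \<lfloor>L * a\<rfloor> + t"
        using fl t(1) M m_eq mL by (intro mod_pos_pos_trivial) auto
      also have "\<dots> < m" using fl t(1) M m_eq by auto
      finally show "(\<lfloor>L * x i\<rfloor> - s) mod L < int m" .
    qed
    have "P \<le> m / L + 1 / q"
    proof (rule ccontr)
      assume "\<not> ?thesis"
      then have less: "1 / q < P - m / L" by simp
      have "1 = (\<Sum>s\<in>S. (1 / real q)\<^sup>2)"
        using q cardS by (simp add: power_divide)
      also have "\<dots> \<le> (\<Sum>s\<in>S. (window_freq x N L m s - m / L)\<^sup>2)"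
      proof (intro sum_mono power_mono)
        fix s assume "s \<in> S"
        from PF[OF this] less show "1 / real q \<le> window_freq x N L m s - m / L" by linarith
      qed simp
      also have "\<dots> \<le> (\<Sum>s\<in>{0..<L}. (window_freq x N L m s - m / L)\<^sup>2)"
        using L by (intro sum_mono2) (auto simp: S_def)
      finally show False using var by simp
    qed
    moreover have "m / L \<le> b - a + 2 / q"
    proof -
      have "real m \<le> L * (b - a) + 2 * (real q)\<^sup>2" using M_le m_real q2L by linarith
      then have "m / L \<le> (L * (b - a) + 2 * (real q)\<^sup>2) / L" using L by (intro divide_right_mono) auto
      also have "\<dots> = b - a + 2 * (real q)\<^sup>2 / L" using L by (simp add: field_simps)
      also have "2 * (real q)\<^sup>2 / L = 2 / q" using q by (simp add: L_def field_simps power3_eq_cube power2_eq_square)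
      finally show ?thesis by simp
    qed
    ultimately have "P \<le> b - a + 2 / q + 1 / q" by linarith
    then show ?case by (simp add: P_def add_divide_distrib[symmetric] add.assoc)
  qed
qed

text \<open>Cutting an interval into quarters removes the length restriction of
  \<open>pair_freq_short_interval\<close>. The lower bound then follows from upper bounds on
  \<open>{0..a}\<close> and \<open>{b..1}\<close>, since the sequence lies in the unit
  interval.\<close>

lemma uniformly_distributed_if_pair_freq:
  assumes x: "\<And>n. n \<ge> 1 \<Longrightarrow> x n \<in> {0..1}"
    and G: "\<And>c. 0 \<le> c \<Longrightarrow> c \<le> 1/2 \<Longrightarrow> (\<lambda>N. pair_freq x N c) \<longlonglongrightarrow> 2 * c"
  shows "uniformly_distributed_mod_1 x"
proof -
  have short: "\<forall>\<^sub>F N in sequentially. frequency N (\<lambda>i. x i \<in> {a..b}) \<le> b - a + \<epsilon>"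
    if "a \<le> b" "b - a \<le> 1/4" "\<epsilon> > 0" for a b \<epsilon>
  proof -
    obtain n :: nat where n: "3 / \<epsilon> < real n" using reals_Archimedean2 by blast
    have "3 / real (n + 5) \<le> \<epsilon>"
      using n \<open>\<epsilon> > 0\<close> by (simp add: field_simps add_increasing)
    moreover have "\<forall>\<^sub>F N in sequentially. frequency N (\<lambda>i. x i \<in> {a..b}) \<le> b - a + 3 / real (n + 5)"
      using G that by (intro pair_freq_short_interval) auto
    ultimately show ?thesis by (auto elim!: eventually_mono)
  qed
  have upper: "\<forall>\<^sub>F N in sequentially. frequency N (\<lambda>i. x i \<in> {a..b}) \<le> b - a + \<epsilon>"
    if "a \<le> b" "b - a \<le> 1" "\<epsilon> > 0" for a b \<epsilon>
  proof -
    define d where "d = (b - a) / 4"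
    have "\<forall>\<^sub>F N in sequentially. \<forall>r\<in>{..<4::nat}.
       frequency N (\<lambda>i. x i \<in> {a + r * d..a + r * d + d}) \<le> d + \<epsilon>/4"
    proof (intro eventually_ball_finite ballI)
      fix r :: nat
      show "\<forall>\<^sub>F N in sequentially. frequency N (\<lambda>i. x i \<in> {a + r * d..a + r * d + d}) \<le> d + \<epsilon>/4"
        using short[of "a + r * d" "a + r * d + d" "\<epsilon>/4"] that by (simp add: d_def)
    qed simp
    then show ?thesis
    proof eventually_elim
      case (elim N)
      have "frequency N (\<lambda>i. x i \<in> {a..b})
              \<le> (\<Sum>r<4::nat. frequency N (\<lambda>i. x i \<in> {a + r * d..a + r * d + d}))"
      proof (rule frequency_cover)
        fix i assume "x i \<in> {a..b}"
        moreover have "b = a + 4 * d" by (simp add: d_def field_simps)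
        ultimately have "x i \<in> {a..a+d} \<or> x i \<in> {a+d..a+2*d} \<or> x i \<in> {a+2*d..a+3*d} \<or> x i \<in> {a+3*d..a+4*d}"
          by auto
        then show "\<exists>r\<in>{..<4::nat}. x i \<in> {a + r * d..a + r * d + d}"
          by (auto simp: numeral_eq_Suc lessThan_Suc)
      qed simp
      also have "\<dots> \<le> (\<Sum>r<4::nat. d + \<epsilon>/4)" using elim by (intro sum_mono) auto
      also have "\<dots> = b - a + \<epsilon>" by (simp add: d_def)
      finally show ?case .
    qed
  qed
  show ?thesis
    unfolding uniformly_distributed_mod_1_iff
  proof (intro allI impI tendstoI)
    fix a b \<epsilon> :: real
    assume ab: "0 \<le> a \<and> a < b \<and> b \<le> 1" and "\<epsilon> > 0"
    let ?F = "\<lambda>N a b. frequency N (\<lambda>i. x i \<in> {a..b})"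
    have "\<forall>\<^sub>F N in sequentially. ?F N a b \<le> b - a + \<epsilon>/3"
      "\<forall>\<^sub>F N in sequentially. ?F N 0 a \<le> a - 0 + \<epsilon>/3"
      "\<forall>\<^sub>F N in sequentially. ?F N b 1 \<le> 1 - b + \<epsilon>/3"
      using ab \<open>\<epsilon> > 0\<close> by (intro upper; linarith)+
    with eventually_gt_at_top[of 0]
    show "\<forall>\<^sub>F N in sequentially. dist (?F N a b) (b - a) < \<epsilon>"
    proof eventually_elim
      case (elim N)
      have "1 \<le> ?F N a b + ?F N 0 a + ?F N b 1"
        using x by (intro frequency_cover3[OF elim(1)]) force
      then show ?case using elim \<open>\<epsilon> > 0\<close> unfolding dist_real_def by linarith
    qed
  qed
qed

section \<open>Counting tuples\<close>

text \<open>Once the first entry \<open>j\<close> is fixed, each condition involves a single further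
  entry, so the admissible tuples form a Cartesian product and the count factors.\<close>

lemma card_tuples:
  fixes k N :: nat
  assumes "k \<ge> 1"
  shows "card {i \<in> {1..k} \<rightarrow>\<^sub>E {1..N}. \<forall>m\<in>{1..k-1}. P m (i 1) (i (m + 1))}
           = (\<Sum>j=1..N. \<Prod>m=1..k-1. card {l \<in> {1..N}. P m j l})"
proof -
  \<comment> \<open>Entry 1 is pinned to \<open>j\<close>; entry \<open>n > 1\<close> is governed by
    condition \<open>n - 1\<close>, hence the shift by \<open>Suc\<close> below.\<close>
  define A where "A j n = (if n = 1 then {j} else {l \<in> {1..N}. P (n - 1) j l})" for j n
  define B where "B = {1..k-1}"
  have k: "{1..k} = insert 1 (Suc ` B)"
    using assms by (auto simp: B_def image_Suc_atLeastAtMost)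
  have B: "finite B" "0 \<notin> B" by (auto simp: B_def)
  have A: "A j (Suc 0) = {j}" "m \<in> B \<Longrightarrow> A j (Suc m) = {l \<in> {1..N}. P m j l}" for j m
    using B by (auto simp: A_def)
  have fibre: "card (Pi\<^sub>E {1..k} (A j)) = (\<Prod>m\<in>B. card {l \<in> {1..N}. P m j l})" for j
  proof -
    have "card (Pi\<^sub>E {1..k} (A j)) = (\<Prod>n\<in>insert 1 (Suc ` B). card (A j n))"
      unfolding k using B by (simp add: card_PiE)
    also have "\<dots> = (\<Prod>n\<in>Suc ` B. card (A j n))"
      using B by (subst prod.insert) (auto simp: A_def)
    also have "\<dots> = (\<Prod>m\<in>B. card (A j (Suc m)))"
      by (subst prod.reindex) auto
    also have "\<dots> = (\<Prod>m\<in>B. card {l \<in> {1..N}. P m j l})"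
      using B by (intro prod.cong) (auto simp: A_def)
    finally show ?thesis .
  qed
  have "{i \<in> {1..k} \<rightarrow>\<^sub>E {1..N}. \<forall>m\<in>B. P m (i 1) (i (m + 1))} = (\<Union>j\<in>{1..N}. Pi\<^sub>E {1..k} (A j))"
    unfolding k by (auto simp: PiE_iff A)
  also have "card \<dots> = (\<Sum>j=1..N. card (Pi\<^sub>E {1..k} (A j)))"
  proof (rule card_UN_disjoint)
    show "\<forall>j\<in>{1..N}. finite (Pi\<^sub>E {1..k} (A j))"
      by (auto intro!: finite_PiE simp: A_def)
    show "\<forall>j\<in>{1..N}. \<forall>j'\<in>{1..N}. j \<noteq> j' \<longrightarrow> Pi\<^sub>E {1..k} (A j) \<inter> Pi\<^sub>E {1..k} (A j') = {}"
      unfolding k by (auto simp: PiE_iff A)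
  qed simp
  finally show ?thesis unfolding fibre unfolding B_def .
qed

text \<open>Deleting the entry at \<open>p\<close> loses nothing, since it equals the entry at
  \<open>q\<close>; \<open>k - 1\<close> free entries remain.\<close>

lemma card_tuples_coincident_le:
  assumes "p \<in> {1..k}" "q \<in> {1..k}" "p \<noteq> q"
  shows "card {i \<in> {1..k} \<rightarrow>\<^sub>E {1..N}. i p = i q} \<le> N ^ (k - 1)"
proof -
  have "card {i \<in> {1..k} \<rightarrow>\<^sub>E {1..N}. i p = i q} \<le> card (({1..k} - {p}) \<rightarrow>\<^sub>E {1..N})"
  proof (rule card_inj_on_le)
    show "inj_on (\<lambda>i. restrict i ({1..k} - {p})) {i \<in> {1..k} \<rightarrow>\<^sub>E {1..N}. i p = i q}"
    proof (rule inj_onI)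
      fix i j
      assume i: "i \<in> {i \<in> {1..k} \<rightarrow>\<^sub>E {1..N}. i p = i q}" and j: "j \<in> {i \<in> {1..k} \<rightarrow>\<^sub>E {1..N}. i p = i q}"
        and r: "restrict i ({1..k} - {p}) = restrict j ({1..k} - {p})"
      have eq: "i n = j n" if "n \<in> {1..k} - {p}" for n
        using fun_cong[OF r, of n] that by simp
      then have "i q = j q" using assms by auto
      then have "i p = j p" using i j by auto
      then have "i n = j n" if "n \<in> {1..k}" for n using eq that by (cases "n = p") auto
      then show "i = j" using i j by (intro PiE_ext[of i "{1..k}" "\<lambda>_. {1..N}" j]) auto
    qed
    show "(\<lambda>i. restrict i ({1..k} - {p})) ` {i \<in> {1..k} \<rightarrow>\<^sub>E {1..N}. i p = i q}
            \<subseteq> ({1..k} - {p}) \<rightarrow>\<^sub>E {1..N}"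
      unfolding image_subset_iff restrict_PiE_iff by (blast intro: PiE_mem)
  qed (simp add: finite_PiE)
  also have "\<dots> = N ^ (k - 1)" using assms by (simp add: card_PiE)
  finally show ?thesis .
qed

text \<open>A union bound over at most \<open>k^2\<close> pairs of positions leaves at most
  \<open>k^2 * N^(k-1)\<close> tuples, which is of order \<open>1/N\<close> relative to
  \<open>N^k\<close>.\<close>

lemma noninjective_tuples_negligible:
  "(\<lambda>N. real (card {i \<in> {1..k} \<rightarrow>\<^sub>E {1..N}. \<not> inj_on i {1..k}}) / real N ^ k) \<longlonglongrightarrow> 0"
proof (rule tendsto_sandwich[of "\<lambda>_. 0"])
  show "\<forall>\<^sub>F N in sequentially.
      real (card {i \<in> {1..k} \<rightarrow>\<^sub>E {1..N}. \<not> inj_on i {1..k}}) / real N ^ k \<le> real (k * k) / real N"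
    using eventually_gt_at_top[of 0]
  proof eventually_elim
    case (elim N)
    define I where "I = {(p, q) \<in> {1..k} \<times> {1..k}. p \<noteq> q}"
    have "I \<subseteq> {1..k} \<times> {1..k}" by (auto simp: I_def)
    then have I: "finite I" "card I \<le> k * k"
      using finite_subset[of I "{1..k} \<times> {1..k}"] card_mono[of "{1..k} \<times> {1..k}" I] by simp_all
    have "card {i \<in> {1..k} \<rightarrow>\<^sub>E {1..N}. \<not> inj_on i {1..k}}
            \<le> card (\<Union>(p, q)\<in>I. {i \<in> {1..k} \<rightarrow>\<^sub>E {1..N}. i p = i q})"
    proof (rule card_mono)
      show "finite (\<Union>(p, q)\<in>I. {i \<in> {1..k} \<rightarrow>\<^sub>E {1..N}. i p = i q})"
        using I by (auto intro!: finite_subset[OF _ finite_PiE[of "{1..k}" "\<lambda>_. {1..N}"]])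
    qed (fastforce simp: I_def inj_on_def)
    also have "\<dots> \<le> (\<Sum>pq\<in>I. card (case pq of (p, q) \<Rightarrow> {i \<in> {1..k} \<rightarrow>\<^sub>E {1..N}. i p = i q}))"
      by (rule card_UN_le[OF I(1)])
    also have "\<dots> \<le> (\<Sum>pq\<in>I. N ^ (k - 1))"
      using card_tuples_coincident_le by (intro sum_mono) (auto simp: I_def)
    also have "\<dots> \<le> k * k * N ^ (k - 1)" using I by simp
    finally have le: "real (card {i \<in> {1..k} \<rightarrow>\<^sub>E {1..N}. \<not> inj_on i {1..k}}) \<le> real (k * k) * real N ^ (k - 1)"
      by (metis of_nat_le_iff of_nat_mult of_nat_power)
    show ?case
    proof (cases "k = 0")
      case False
      then have "real N ^ k = real N * real N ^ (k - 1)" by (simp add: power_eq_if)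
      then show ?thesis using le elim by (simp add: field_simps)
    qed simp
  qed
  show "(\<lambda>N. real (k * k) / real N) \<longlonglongrightarrow> 0"
    by (rule lim_const_over_n)
qed auto

text \<open>Passes to a count over all tuples, which factors by \<open>card_tuples\<close>. For
  \<open>N > 0\<close> the difference is exactly the normalised number of tuples in the rectangle
  with a repeated index, hence lies between 0 and a null sequence.\<close>

lemma correlation_count_asymp:
  assumes k: "k \<ge> 1"
  shows "(\<lambda>N. (\<Sum>j=1..N. \<Prod>m=1..k-1. frequency N (\<lambda>l. signed_dist (x j - x l) \<in> {a m..b m})) / real N
            - correlation_count x k 0 (\<Pi>\<^sub>E m\<in>{1..k-1}. {a m..b m}) N) \<longlonglongrightarrow> 0"
    (is "(\<lambda>N. ?full N - ?corr N) \<longlonglongrightarrow> 0")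
proof (rule tendsto_sandwich[OF _ _ tendsto_const noninjective_tuples_negligible[of k]])
  define P where "P m j l \<longleftrightarrow> signed_dist (x j - x l) \<in> {a m..b m}" for m j l
  define T where "T N = {i \<in> {1..k} \<rightarrow>\<^sub>E {1..N}. \<forall>m\<in>{1..k-1}. P m (i 1) (i (m + 1))}" for N
  have fin: "finite ({1..k} \<rightarrow>\<^sub>E {1..N})" for N :: nat by (simp add: finite_PiE)
  have full: "?full N = real (card (T N)) / real N ^ k" for N
  proof -
    have "real N * real N ^ (k - 1) = real N ^ k" using k by (simp add: power_eq_if)
    moreover have "real (card (T N)) = (\<Sum>j=1..N. \<Prod>m=1..k-1. real (card {l \<in> {1..N}. P m j l}))"
      unfolding T_def card_tuples[OF k] by simp
    ultimately show ?thesis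
      unfolding frequency_def P_def[symmetric]
      by (simp add: prod_dividef sum_divide_distrib[symmetric] mult.commute)
  qed
  \<comment> \<open>For \<open>N > 0\<close> the factor \<open>N powr 0\<close> is 1, so the
    differences are unscaled, and the normalisation is the \<open>k\<close>-th power of
    \<open>N\<close>.\<close>
  have corr: "?corr N = real (card {i \<in> T N. inj_on i {1..k}}) / real N ^ k" if "N > 0" for N
  proof -
    have "{i \<in> {1..k} \<rightarrow>\<^sub>E {1..N}. inj_on i {1..k} \<and>
            scaled_differences x k 0 N i \<in> (\<Pi>\<^sub>E m\<in>{1..k-1}. {a m..b m})} = {i \<in> T N. inj_on i {1..k}}"
      using that by (auto simp: T_def P_def scaled_differences_def PiE_iff)
    then show ?thesis
      using that by (simp add: correlation_count_def powr_realpow)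
  qed
  have T: "finite (T N)" for N unfolding T_def using fin by (rule rev_finite_subset) auto
  have diff: "?full N - ?corr N = real (card {i \<in> T N. \<not> inj_on i {1..k}}) / real N ^ k" if "N > 0" for N
  proof -
    have "card (T N) = card ({i \<in> T N. inj_on i {1..k}} \<union> {i \<in> T N. \<not> inj_on i {1..k}})"
      by (rule arg_cong[where f = card]) auto
    also have "\<dots> = card {i \<in> T N. inj_on i {1..k}} + card {i \<in> T N. \<not> inj_on i {1..k}}"
      using T[of N] by (intro card_Un_disjoint) auto
    finally show ?thesis unfolding full corr[OF that] by (simp add: add_divide_distrib)
  qed
  show "\<forall>\<^sub>F N in sequentially. 0 \<le> ?full N - ?corr N"
    using eventually_gt_at_top[of 0] by eventually_elim (simp only: diff, simp)
  show "\<forall>\<^sub>F N in sequentially. ?full N - ?corr N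
          \<le> real (card {i \<in> {1..k} \<rightarrow>\<^sub>E {1..N}. \<not> inj_on i {1..k}}) / real N ^ k"
    using eventually_gt_at_top[of 0]
  proof eventually_elim
    case (elim N)
    show ?case
      unfolding diff[OF elim] using fin[of N]
      by (intro divide_right_mono of_nat_mono card_mono) (auto simp: T_def)
  qed
qed

section \<open>Volumes of rectangles and the two implications\<close>

lemma measure_rectangle:
  assumes "finite I" "\<And>m. m \<in> I \<Longrightarrow> a m \<le> b m"
  shows "measure (Pi\<^sub>M I (\<lambda>_. lborel)) (\<Pi>\<^sub>E m\<in>I. {a m..b m}) = (\<Prod>m\<in>I. b m - a m :: real)"
proof -
  interpret product_sigma_finite "\<lambda>_. lborel :: real measure" ..
  have "emeasure (Pi\<^sub>M I (\<lambda>_. lborel)) (\<Pi>\<^sub>E m\<in>I. {a m..b m}) = (\<Prod>m\<in>I. emeasure lborel {a m..b m})"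
    using assms(1) by (intro emeasure_PiM) auto
  also have "\<dots> = (\<Prod>m\<in>I. ennreal (b m - a m))"
    using assms(2) by (intro prod.cong) auto
  also have "\<dots> = ennreal (\<Prod>m\<in>I. b m - a m)"
    using assms(2) by (intro prod_ennreal) auto
  finally show ?thesis
    using assms(2) by (simp add: measure_def prod_nonneg)
qed

text \<open>For factors of absolute value at most 1, two products differ by at most the sum of the
  differences of their factors. The estimate of \<open>frequency_signed_dist_uniform\<close> is
  uniform in the centre, so it applies to all \<open>x j\<close> at once and survives averaging over
  \<open>j\<close>.\<close>

lemma poissonian_if_uniformly_distributed:
  assumes "k \<ge> 1" and x: "\<And>n. n \<ge> 1 \<Longrightarrow> x n \<in> {0..1}"
    and ud: "uniformly_distributed_mod_1 x"
  shows "poissonian_k0_correlations k x"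
  unfolding poissonian_k0_correlations_def
proof (intro allI impI, elim conjE)
  fix R assume "closed_rectangle (k - 1) R" and R_sub: "R \<subseteq> (\<Pi>\<^sub>E m\<in>{1..k-1}. {-(1/2)..1/2})"
  then obtain a b where ab: "\<And>m. m \<in> {1..k-1} \<Longrightarrow> a m \<le> b m" and R: "R = (\<Pi>\<^sub>E m\<in>{1..k-1}. {a m..b m})"
    unfolding closed_rectangle_def by blast
  have half: "-(1/2) \<le> a m" "b m \<le> 1/2" if "m \<in> {1..k-1}" for m
  proof -
    \<comment> \<open>The two extreme corners belong to \<open>R\<close> because
      \<open>a m \<le> b m\<close>, so the inclusion bounds each side separately.\<close>
    have "(\<lambda>m\<in>{1..k-1}. a m) \<in> R" "(\<lambda>m\<in>{1..k-1}. b m) \<in> R"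
      unfolding R using ab by auto
    then have "(\<lambda>m\<in>{1..k-1}. a m) m \<in> {-(1/2)..1/2}" "(\<lambda>m\<in>{1..k-1}. b m) m \<in> {-(1/2)..1/2}"
      using R_sub that by (blast intro: PiE_mem)+
    with that show "-(1/2) \<le> a m" "b m \<le> 1/2" by auto
  qed
  let ?f = "\<lambda>N m j. frequency N (\<lambda>l. signed_dist (x j - x l) \<in> {a m..b m})"
  let ?full = "\<lambda>N. (\<Sum>j=1..N. \<Prod>m=1..k-1. ?f N m j) / real N"
  have "?full \<longlonglongrightarrow> (\<Prod>m=1..k-1. b m - a m)"
  proof (rule tendstoI)
    fix \<epsilon> :: real assume "\<epsilon> > 0"
    define \<delta> where "\<delta> = \<epsilon> / (real k + 1)"
    have "\<delta> > 0" using \<open>\<epsilon> > 0\<close> by (simp add: \<delta>_def)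
    have "\<forall>\<^sub>F N in sequentially. \<forall>y a b. -(1/2) \<le> a \<and> a \<le> b \<and> b \<le> 1/2 \<longrightarrow>
           \<bar>frequency N (\<lambda>j. signed_dist (y - x j) \<in> {a..b}) - (b - a)\<bar> \<le> \<delta>"
      using ud x \<open>\<delta> > 0\<close> by (rule frequency_signed_dist_uniform)
    with eventually_gt_at_top[of 0]
    show "\<forall>\<^sub>F N in sequentially. dist (?full N) (\<Prod>m=1..k-1. b m - a m) < \<epsilon>"
    proof eventually_elim
      case (elim N)
      have each: "\<bar>(\<Prod>m=1..k-1. ?f N m j) - (\<Prod>m=1..k-1. b m - a m)\<bar> \<le> real k * \<delta>" for j
      proof -
        have "norm ((\<Prod>m=1..k-1. ?f N m j) - (\<Prod>m=1..k-1. b m - a m))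
                \<le> (\<Sum>m=1..k-1. norm (?f N m j - (b m - a m)))"
        proof (rule norm_prod_diff)
          fix m assume m: "m \<in> {1..k-1}"
          show "norm (?f N m j) \<le> 1" using frequency_nonneg frequency_le_1 by simp
          show "norm (b m - a m) \<le> 1" using half[OF m] ab[OF m] by simp
        qed
        also have "\<dots> \<le> (\<Sum>m=1..k-1. \<delta>)"
        proof (rule sum_mono)
          fix m assume m: "m \<in> {1..k-1}"
          show "norm (?f N m j - (b m - a m)) \<le> \<delta>"
            using elim(2) half[OF m] ab[OF m] by simp
        qed
        also have "\<dots> \<le> real k * \<delta>" using \<open>\<delta> > 0\<close> by simp
        finally show ?thesis by simp
      qed
      have "?full N - (\<Prod>m=1..k-1. b m - a m)
              = (\<Sum>j=1..N. (\<Prod>m=1..k-1. ?f N m j) - (\<Prod>m=1..k-1. b m - a m)) / real N"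
        using elim(1) by (simp add: sum_subtractf field_simps)
      also have "\<bar>\<dots>\<bar> \<le> (\<Sum>j=1..N. real k * \<delta>) / real N"
        unfolding abs_divide abs_of_nat
        by (intro divide_right_mono order_trans[OF sum_abs] sum_mono each) simp
      also have "\<dots> = real k * \<delta>" using elim(1) by simp
      also have "\<dots> < \<epsilon>" using \<open>\<epsilon> > 0\<close> by (simp add: \<delta>_def field_simps)
      finally show ?case by (simp add: dist_real_def)
    qed
  qed
  moreover have "measure (Pi\<^sub>M {1..k-1} (\<lambda>_. lborel)) R = (\<Prod>m=1..k-1. b m - a m)"
    unfolding R using ab by (intro measure_rectangle) auto
  ultimately have "?full \<longlonglongrightarrow> measure (Pi\<^sub>M {1..k-1} (\<lambda>_. lborel)) R" by simp
  from tendsto_diff[OF this correlation_count_asymp[OF \<open>k \<ge> 1\<close>, of x a b]]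
  show "(\<lambda>N. correlation_count x k 0 R N) \<longlonglongrightarrow> measure (Pi\<^sub>M {1..k-1} (\<lambda>_. lborel)) R"
    by (simp add: R)
qed

text \<open>Sides \<open>{-(1/2)..1/2}\<close> in all coordinates but the first impose no condition:
  their frequencies are 1 and their lengths are 1. What remains is the first coordinate with side
  \<open>{- c..c}\<close>.\<close>

lemma pair_freq_if_poissonian:
  assumes k: "k \<ge> 2" and "poissonian_k0_correlations k x" and c: "0 \<le> c" "c \<le> 1/2"
  shows "(\<lambda>N. pair_freq x N c) \<longlonglongrightarrow> 2 * c"
proof -
  define b where "b m = (if m = 1 then c else 1/2)" for m :: nat
  have b: "0 \<le> b m" "b m \<le> 1/2" for m using c by (auto simp: b_def)
  have k1: "{1..k-1} = insert 1 {2..k-1}" using k by auto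
  let ?R = "\<Pi>\<^sub>E m\<in>{1..k-1}. {- b m..b m}"
  have "closed_rectangle (k - 1) ?R"
    unfolding closed_rectangle_def using b by (intro exI[of _ "\<lambda>m. - b m"] exI[of _ b]) simp
  moreover have "?R \<subseteq> (\<Pi>\<^sub>E m\<in>{1..k-1}. {-(1/2)..1/2})"
    using b by (intro PiE_mono) simp
  ultimately have "(\<lambda>N. correlation_count x k 0 ?R N) \<longlonglongrightarrow> measure (Pi\<^sub>M {1..k-1} (\<lambda>_. lborel)) ?R"
    using assms(2) unfolding poissonian_k0_correlations_def by blast
  also have "measure (Pi\<^sub>M {1..k-1} (\<lambda>_. lborel)) ?R = (\<Prod>m\<in>{1..k-1}. b m - - b m)"
    using b by (intro measure_rectangle) auto
  also have "\<dots> = 2 * c" unfolding k1 by (simp add: b_def)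
  finally have corr: "(\<lambda>N. correlation_count x k 0 ?R N) \<longlonglongrightarrow> 2 * c" .
  have "k \<ge> 1" using k by simp
  from tendsto_add[OF correlation_count_asymp[OF this, of x "\<lambda>m. - b m" b] corr]
  have "(\<lambda>N. (\<Sum>j=1..N. \<Prod>m=1..k-1. frequency N (\<lambda>l. signed_dist (x j - x l) \<in> {- b m..b m})) / real N)
          \<longlonglongrightarrow> 2 * c" by simp
  moreover have "\<forall>\<^sub>F N in sequentially.
     (\<Sum>j=1..N. \<Prod>m=1..k-1. frequency N (\<lambda>l. signed_dist (x j - x l) \<in> {- b m..b m})) / real N = pair_freq x N c"
    using eventually_gt_at_top[of 0]
  proof eventually_elim
    case (elim N)
    have one: "frequency N (\<lambda>l. signed_dist (x j - x l) \<in> {- b m..b m}) = 1" if "m \<noteq> 1" for j m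
    proof (rule frequency_True[OF elim])
      fix l show "signed_dist (x j - x l) \<in> {- b m..b m}"
        using that signed_dist_bounds[of "x j - x l"] by (simp add: b_def)
    qed
    have "(\<Prod>m=1..k-1. frequency N (\<lambda>l. signed_dist (x j - x l) \<in> {- b m..b m}))
            = frequency N (\<lambda>l. \<bar>signed_dist (x j - x l)\<bar> \<le> c)" for j
    proof -
      have "(\<Prod>m\<in>{2..k-1}. frequency N (\<lambda>l. signed_dist (x j - x l) \<in> {- b m..b m})) = 1"
        by (intro prod.neutral ballI one) auto
      then have "(\<Prod>m=1..k-1. frequency N (\<lambda>l. signed_dist (x j - x l) \<in> {- b m..b m}))
            = frequency N (\<lambda>l. signed_dist (x j - x l) \<in> {- b 1..b 1})"
        unfolding k1 by (subst prod.insert) auto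
      also have "\<dots> = frequency N (\<lambda>l. \<bar>signed_dist (x j - x l)\<bar> \<le> c)"
        by (rule frequency_cong) (auto simp: b_def)
      finally show ?thesis .
    qed
    then show ?case by (simp add: pair_freq_def)
  qed
  ultimately show ?thesis by (rule Lim_transform_eventually)
qed

theorem theorem7:
  fixes k :: nat and x :: "nat \<Rightarrow> real"
  assumes "k \<ge> 2"
    and "\<And>n. n \<ge> 1 \<Longrightarrow> x n \<in> {0..1}"
  shows "uniformly_distributed_mod_1 x \<longleftrightarrow> poissonian_k0_correlations k x"
proof
  assume "uniformly_distributed_mod_1 x"
  then show "poissonian_k0_correlations k x"
    using assms by (intro poissonian_if_uniformly_distributed) auto
next
  assume "poissonian_k0_correlations k x"
  then show "uniformly_distributed_mod_1 x"
    using assms by (intro uniformly_distributed_if_pair_freq pair_freq_if_poissonian) auto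
qed

end
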